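(* Let $\alpha>0$, let $F$ be a continuous distribution function of a positive random variable $X$ with $m(\alpha)=E(X^\alpha)<\infty$, and let $R(x)=\sum_{n=0}^{\infty}F^{\boxtimes n}(x)$ be the Kendall renewal function of $F$. If $\overline{F}\in RV_{-\beta}$ with $\beta>\alpha$, then $$\lim_{x\to\infty}\frac{1}{x^{2\alpha}\overline{F}(x)}\left(R(x)-\frac{2}{m(\alpha)}x^{\alpha}\right)=\frac{3\alpha-\beta}{(\beta-\alpha)m^{2}(\alpha)},$$ and $$\lim_{x\to\infty}\frac{1}{x^{3\alpha}\overline{F}^{2}(x)}\left(R(x)-\frac{2x^{\alpha}}{m(\alpha)}-\frac{2\alpha x^{\alpha}\overline{W}_{\alpha}(x)}{m^{2}(\alpha)}+\frac{x^{2\alpha}\overline{F}(x)}{m^{2}(\alpha)}\right)=\frac{2\alpha(2\alpha-\beta)}{m^{3}(\alpha)(\beta-\alpha)^{2}}.$$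
   Context: Fix $\alpha>0$. $X$ is a positive random variable with distribution function $F(x)=P(X\le x)$, $F(0-)=0$, $F$ continuous; $\overline{F}=1-F$; $m(\alpha)=\int_0^\infty y^\alpha\,dF(y)$; $m^k(\alpha)$ means $(m(\alpha))^k$; $\overline{W}_\alpha(x)=\int_x^\infty y^{\alpha-1}\overline{F}(y)\,dy$. The Williamson transform ($G$-transform) of a distribution function $F$ with $F(0-)=0$ is $G_F(x)=\int_0^x\bigl(1-(t/x)^\alpha\bigr)\,dF(t)$, $x>0$. The Kendall convolution $F_1\boxtimes F_2$ of two distribution functions with $F_i(0-)=0$ is the distribution function $F_3$ (with $F_3(0-)=0$) determined by $G_{F_3}(x)=G_{F_1}(x)G_{F_2}(x)$. The $n$-fold Kendall convolution $F^{\boxtimes n}$ is thus the distribution function with $G$-transform $G_F^n$, and $F^{\boxtimes 0}$ is the distribution function of the point mass at $0$. A positive measurable function $f$ is regularly varying with index $\rho\in\mathbb{R}$, written $f\in RV_\rho$, if $\lim_{x\to\infty}f(tx)/f(x)=t^\rho$ for all $t>0$. *)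

theory Defs
  imports "HOL-Probability.Probability"
begin

text \<open>Distribution functions \<open>F\<close> with \<open>F(0-) = 0\<close>; an atom at \<open>0\<close> is allowed. Integrals
  with respect to \<open>dF\<close> are integrals with respect to \<^const>\<open>interval_measure\<close> \<open>F\<close>.\<close>

definition nonneg_distribution_function :: "(real \<Rightarrow> real) \<Rightarrow> bool" where
  "nonneg_distribution_function F \<longleftrightarrow>
     mono F \<and> (\<forall>a. continuous (at_right a) F) \<and>
     (F \<longlongrightarrow> 0) at_bot \<and> (F \<longlongrightarrow> 1) at_top \<and> (F \<longlongrightarrow> 0) (at_left 0)"

text \<open>The range of integration contains \<open>0\<close>, so that the point mass at \<open>0\<close> has transform \<open>1\<close>.
  Only the values at \<open>x > 0\<close> are meaningful.\<close>

definition G_transform :: "real \<Rightarrow> (real \<Rightarrow> real) \<Rightarrow> real \<Rightarrow> real" where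
  "G_transform \<alpha> F x = (LINT t:{0..x}|interval_measure F. 1 - (t / x) powr \<alpha>)"

definition kendall_conv :: "real \<Rightarrow> (real \<Rightarrow> real) \<Rightarrow> (real \<Rightarrow> real) \<Rightarrow> real \<Rightarrow> real" where
  "kendall_conv \<alpha> F1 F2 =
     (THE F3. nonneg_distribution_function F3 \<and>
        (\<forall>x>0. G_transform \<alpha> F3 x = G_transform \<alpha> F1 x * G_transform \<alpha> F2 x))"

primrec kendall_power :: "real \<Rightarrow> (real \<Rightarrow> real) \<Rightarrow> nat \<Rightarrow> real \<Rightarrow> real" where
  "kendall_power \<alpha> F 0 = indicator {0..}"
| "kendall_power \<alpha> F (Suc n) = kendall_conv \<alpha> (kendall_power \<alpha> F n) F"

definition kendall_renewal :: "real \<Rightarrow> (real \<Rightarrow> real) \<Rightarrow> real \<Rightarrow> real" where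
  "kendall_renewal \<alpha> F x = (\<Sum>n. kendall_power \<alpha> F n x)"

definition W_bar :: "real \<Rightarrow> (real \<Rightarrow> real) \<Rightarrow> real \<Rightarrow> real" where
  "W_bar \<alpha> F x = (LINT y:{x..}|lborel. y powr (\<alpha> - 1) * (1 - F y))"

definition RV :: "real \<Rightarrow> (real \<Rightarrow> real) set" where
  "RV \<rho> = {f. set_borel_measurable borel {0<..} f \<and> (\<forall>x>0. f x > 0) \<and>
     (\<forall>t>0. ((\<lambda>x. f (t * x) / f x) \<longlongrightarrow> t powr \<rho>) at_top)}"

end

theory Submission
  imports Defs
begin

text \<open>Let \<open>G\<close> be the Williamson transform of \<open>F\<close> and let \<open>W\<close> be the weighted tail
  \<open>W x = \<integral>\<^bsub>x\<^esub>\<^bsup>\<infinity>\<^esup> y\<^bsup>\<alpha>-1\<^esup> (1 - F y) dy\<close>. Everything rests on an exact formula for the renewal function.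

  By Tonelli, \<open>x\<^sup>\<alpha> G x = \<integral>\<^bsub>0\<^esub>\<^bsup>x\<^esup> \<alpha> s\<^bsup>\<alpha>-1\<^esup> F s ds\<close> (\<open>has_integral_G_transform\<close>). Differentiating recovers
  \<open>F = G + x G' / \<alpha>\<close>, so the transform is injective among distribution functions
  (\<open>G_transform_inject\<close>), and the only possible candidate with transform \<open>G\<^bsup>n+1\<^esup>\<close> is
  \<open>G\<^sup>n (F + n (F - G))\<close>. That this candidate is a distribution function is not obvious; its
  monotonicity comes from \<open>G \<le> F\<close> and the convexity of powers (\<open>kendall_power_formula_mono\<close>). Hence
  the definite descriptions defining the Kendall powers denote these functions
  (\<open>kendall_power_Suc\<close>), and summation of a geometric series and of its derivative gives
  \<open>R = 2 / (1 - G) - (1 - F) / (1 - G)\<^sup>2\<close> (\<open>kendall_renewal_eq\<close>).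

  The same Tonelli argument, applied to the whole moment, gives \<open>1 - G x = x\<^sup>-\<^sup>\<alpha> (m - \<alpha> W x)\<close>
  (\<open>powr_mult_one_minus_G\<close>). Thus \<open>R x\<close> is a rational function of \<open>x\<^sup>\<alpha>\<close>, \<open>1 - F x\<close> and \<open>W x\<close>. Subtracting the
  leading terms and dividing by the stated normalisation leaves an expression in \<open>W x\<close> and
  \<open>r x = W x / (x\<^sup>\<alpha> (1 - F x))\<close> alone (\<open>renewal_remainder_identities\<close>). Since the moment is finite, \<open>W\<close>
  tends to \<open>0\<close>, and Karamata's theorem (\<open>Karamata_tail_integral\<close>) says that \<open>r\<close> tends to \<open>1 / (\<beta> - \<alpha>)\<close>; both
  limits follow by continuity. As \<open>1 - F\<close> is monotone, Karamata's theorem only needs an elementary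
  dyadic form of Potter's bound.\<close>

section \<open>Moments as weighted tail integrals\<close>

lemma has_integral_powr_density:
  fixes \<alpha> c :: real
  assumes "\<alpha> > 0" "c \<ge> 0"
  shows "((\<lambda>s. \<alpha> * s powr (\<alpha> - 1)) has_integral c powr \<alpha>) {0..c}"
proof -
  have "((\<lambda>s. s powr (\<alpha> - 1)) has_integral (c powr (\<alpha> - 1 + 1) / (\<alpha> - 1 + 1))) {0..c}"
    using assms by (intro has_integral_powr_from_0) auto
  then show ?thesis
    using assms by (auto dest: has_integral_mult_right[where c = \<alpha>])
qed

lemma nn_integral_powr_density:
  fixes \<alpha> c :: real
  assumes "\<alpha> > 0" "c \<ge> 0"
  shows "(\<integral>\<^sup>+s\<in>{0<..<c}. ennreal (\<alpha> * s powr (\<alpha> - 1)) \<partial>lborel) = ennreal (c powr \<alpha>)"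
proof -
  let ?f = "\<lambda>s. \<alpha> * s powr (\<alpha> - 1) * indicator {0<..<c} s"
  have "((\<lambda>s. \<alpha> * s powr (\<alpha> - 1)) has_integral c powr \<alpha>) {0<..<c}"
    using has_integral_powr_density[OF assms] by (simp add: has_integral_Icc_iff_Ioo)
  then have "(?f has_integral c powr \<alpha>) UNIV"
    by (subst (asm) has_integral_restrict_UNIV[symmetric])
       (auto elim!: has_integral_eq[rotated] simp: indicator_def)
  then have "integral\<^sup>N lborel ?f = c powr \<alpha>"
    using assms by (intro nn_integral_has_integral_lborel) auto
  then show ?thesis
    by (subst nn_integral_cong[where v = "\<lambda>s. ennreal (?f s)"]) (auto simp: indicator_def)
qed

lemma (in real_distribution) measure_Ioi: "measure M {s<..} = 1 - cdf M s"
proof -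
  have "{s<..} = space M - {..s}" by auto
  then show ?thesis
    using prob_compl[of "{..s}"] by (simp add: cdf_def)
qed

text \<open>Tonelli for the region \<open>0 < s < t\<close>. The free set \<open>S\<close> serves two purposes: \<open>S = UNIV\<close> gives the
  moment of order \<open>\<alpha>\<close> of a nonnegative distribution, and \<open>S = {..<x}\<close> gives the truncated moment
  \<open>E (min X x)\<^sup>\<alpha>\<close>, which is the Williamson transform in disguise.\<close>

lemma (in real_distribution) layer_cake_powr:
  assumes [measurable]: "S \<in> sets borel"
  shows "(\<integral>\<^sup>+t. (\<integral>\<^sup>+s\<in>{0<..<t} \<inter> S. ennreal (\<alpha> * s powr (\<alpha> - 1)) \<partial>lborel) \<partial>M) =
         (\<integral>\<^sup>+s\<in>{0<..} \<inter> S. ennreal (\<alpha> * s powr (\<alpha> - 1) * (1 - cdf M s)) \<partial>lborel)"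
proof -
  interpret P: pair_sigma_finite lborel M
    by (intro pair_sigma_finite.intro sigma_finite_lborel sigma_finite_measure_axioms)
  let ?w = "\<lambda>s. ennreal (\<alpha> * s powr (\<alpha> - 1)) * indicator ({0<..} \<inter> S) s"
  have [measurable]: "(\<lambda>(s, t). indicator {s<..} t :: ennreal) \<in> borel_measurable (lborel \<Otimes>\<^sub>M M)"
  proof -
    have "Measurable.pred (lborel \<Otimes>\<^sub>M M) (\<lambda>p. fst p < snd p)"
      by measurable
    then show ?thesis
      by (simp add: indicator_def case_prod_beta')
  qed
  have "(\<integral>\<^sup>+t. (\<integral>\<^sup>+s\<in>{0<..<t} \<inter> S. ennreal (\<alpha> * s powr (\<alpha> - 1)) \<partial>lborel) \<partial>M) =
        (\<integral>\<^sup>+t. \<integral>\<^sup>+s. ?w s * indicator {s<..} t \<partial>lborel \<partial>M)"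
    by (intro nn_integral_cong) (auto simp: indicator_def)
  also have "\<dots> = (\<integral>\<^sup>+s. \<integral>\<^sup>+t. ?w s * indicator {s<..} t \<partial>M \<partial>lborel)"
    by (rule P.Fubini') measurable
  also have "\<dots> = (\<integral>\<^sup>+s. ?w s * ennreal (1 - cdf M s) \<partial>lborel)"
    by (simp add: nn_integral_cmult emeasure_eq_measure measure_Ioi)
  also have "\<dots> = (\<integral>\<^sup>+s\<in>{0<..} \<inter> S. ennreal (\<alpha> * s powr (\<alpha> - 1) * (1 - cdf M s)) \<partial>lborel)"
    by (intro nn_integral_cong) (auto simp: indicator_def ennreal_mult'' cdf_bounded_prob)
  finally show ?thesis .
qed

lemma (in real_distribution) expectation_powr_eq_tail_integral:
  assumes \<alpha>: "\<alpha> > 0" and AE0: "AE t in M. 0 \<le> t" and int: "integrable M (\<lambda>t. t powr \<alpha>)"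
  shows "set_integrable lborel {0<..} (\<lambda>s. \<alpha> * s powr (\<alpha> - 1) * (1 - cdf M s))"
    and "(LINT s:{0<..}|lborel. \<alpha> * s powr (\<alpha> - 1) * (1 - cdf M s)) = expectation (\<lambda>t. t powr \<alpha>)"
proof -
  let ?f = "\<lambda>s. indicator {0<..} s * (\<alpha> * s powr (\<alpha> - 1) * (1 - cdf M s))"
  have [measurable]: "cdf M \<in> borel_measurable borel"
    by (intro borel_measurable_mono monoI cdf_nondecreasing)
  have "ennreal (expectation (\<lambda>t. t powr \<alpha>)) = (\<integral>\<^sup>+t. t powr \<alpha> \<partial>M)"
    using int by (intro nn_integral_eq_integral[symmetric]) auto
  also have "\<dots> = (\<integral>\<^sup>+t. (\<integral>\<^sup>+s\<in>{0<..<t} \<inter> UNIV. ennreal (\<alpha> * s powr (\<alpha> - 1)) \<partial>lborel) \<partial>M)"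
    using AE0 by (intro nn_integral_cong_AE) (auto simp: nn_integral_powr_density \<alpha>)
  also have "\<dots> = integral\<^sup>N lborel ?f"
    by (subst layer_cake_powr) (auto intro!: nn_integral_cong simp: indicator_def)
  finally have "integral\<^sup>N lborel ?f = ennreal (expectation (\<lambda>t. t powr \<alpha>))" ..
  moreover have "0 \<le> ?f s" for s
    using \<alpha> cdf_bounded_prob[of s] by (auto simp: indicator_def)
  moreover have "0 \<le> expectation (\<lambda>t. t powr \<alpha>)"
    by simp
  ultimately have "integrable lborel ?f \<and> integral\<^sup>L lborel ?f = expectation (\<lambda>t. t powr \<alpha>)"
    by (subst nn_integral_eq_integrable[symmetric]) auto
  then show "set_integrable lborel {0<..} (\<lambda>s. \<alpha> * s powr (\<alpha> - 1) * (1 - cdf M s))"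
    and "(LINT s:{0<..}|lborel. \<alpha> * s powr (\<alpha> - 1) * (1 - cdf M s)) = expectation (\<lambda>t. t powr \<alpha>)"
    by (simp_all add: set_integrable_def set_lebesgue_integral_def)
qed

section \<open>The Williamson transform as a weighted average\<close>

lemma
  assumes "nonneg_distribution_function K"
  shows distribution_mono: "mono K"
    and distribution_right_cont: "\<And>a. continuous (at_right a) K"
    and distribution_at_top: "(K \<longlongrightarrow> 1) at_top"
    and distribution_le_1: "\<And>x. K x \<le> 1"
    and distribution_neg: "\<And>x. x < 0 \<Longrightarrow> K x = 0"
    and real_distribution_of: "real_distribution (interval_measure K)"
    and cdf_of: "cdf (interval_measure K) = K"
    and AE_nonneg_of: "AE t in interval_measure K. 0 \<le> t"
proof -
  have K: "mono K" "\<And>a. continuous (at_right a) K" "(K \<longlongrightarrow> 0) at_bot" "(K \<longlongrightarrow> 1) at_top"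
    using assms by (auto simp: nonneg_distribution_function_def)
  then show "mono K" "\<And>a. continuous (at_right a) K" "(K \<longlongrightarrow> 1) at_top"
    by auto
  show rd: "real_distribution (interval_measure K)"
    using K by (intro real_distribution_interval_measure) (auto dest: monoD)
  then interpret real_distribution "interval_measure K" .
  show cdf: "cdf (interval_measure K) = K"
    using K by (intro cdf_interval_measure) (auto dest: monoD)
  have nn: "0 \<le> K x" for x
    using cdf_nonneg[of x] by (simp add: cdf)
  show "K x \<le> 1" for x
    using cdf_bounded_prob[of x] by (simp add: cdf)
  have lim: "(K \<longlongrightarrow> 0) (at_left 0)"
    using assms by (auto simp: nonneg_distribution_function_def)
  show "K x = 0" if "x < 0" for x
  proof (rule antisym)
    have "eventually (\<lambda>y. K x \<le> K y) (at_left 0)"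
      using eventually_at_left_real[OF that] by eventually_elim (auto intro: monoD[OF K(1)])
    with lim show "K x \<le> 0"
      by (intro tendsto_lowerbound[OF lim]) auto
  qed (fact nn)
  have "(K \<longlongrightarrow> measure (interval_measure K) {..<0}) (at_left 0)"
    using cdf_at_left[of 0] by (simp add: cdf)
  with lim have "measure (interval_measure K) {..<0} = 0"
    using tendsto_unique[OF trivial_limit_at_left_real] by blast
  then have "emeasure (interval_measure K) {..<0} = 0"
    by (simp add: emeasure_eq_measure)
  then show "AE t in interval_measure K. 0 \<le> t"
    by (intro AE_I[of _ _ "{..<0}"]) auto
qed

lemma G_kernel_bounds:
  fixes \<alpha> t x :: real
  assumes "\<alpha> > 0"
  shows "0 \<le> indicator {0..x} t * (1 - (t / x) powr \<alpha>)"
    and "indicator {0..x} t * (1 - (t / x) powr \<alpha>) \<le> indicator {0..x} t"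
proof -
  have "(t / x) powr \<alpha> \<le> 1" if "t \<in> {0..x}"
    using that assms by (intro powr_le1) (auto simp: divide_simps)
  then show "0 \<le> indicator {0..x} t * (1 - (t / x) powr \<alpha>)"
    and "indicator {0..x} t * (1 - (t / x) powr \<alpha>) \<le> indicator {0..x} t"
    by (auto simp: indicator_def)
qed

lemma G_transform_bounds:
  assumes \<alpha>: "\<alpha> > 0" and K: "nonneg_distribution_function K"
  shows "0 \<le> G_transform \<alpha> K x" "G_transform \<alpha> K x \<le> K x"
proof -
  interpret real_distribution "interval_measure K"
    using K by (rule real_distribution_of)
  let ?g = "\<lambda>t. indicator {0..x} t * (1 - (t / x) powr \<alpha>)"
  have G: "G_transform \<alpha> K x = (LINT t|interval_measure K. ?g t)"
    by (simp add: G_transform_def set_lebesgue_integral_def)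
  have b: "0 \<le> ?g t" "?g t \<le> indicator {0..x} t" for t
    using G_kernel_bounds[OF \<alpha>] by auto
  show "0 \<le> G_transform \<alpha> K x"
    unfolding G using b by (intro integral_nonneg_AE) auto
  have "(LINT t|interval_measure K. ?g t) \<le> (LINT t|interval_measure K. indicator {..x} t)"
  proof (rule integral_mono)
    have "norm (?g t) \<le> 1" for t
      using b[of t] by (auto simp: indicator_def split: if_splits)
    then show "integrable (interval_measure K) ?g"
      by (intro integrable_const_bound[where B = 1] AE_I2) auto
    show "?g t \<le> indicator {..x} t" for t
      using b(2)[of t] by (auto simp: indicator_def split: if_splits)
  qed (auto simp: emeasure_eq_measure)
  also have "\<dots> = cdf (interval_measure K) x"
    by (simp add: cdf_def)
  finally show "G_transform \<alpha> K x \<le> K x"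
    by (simp add: G cdf_of[OF K])
qed

text \<open>For \<open>t \<ge> 0\<close> the kernel of the transform, extended by \<open>0\<close> beyond \<open>x\<close>, equals
  \<open>1 - (min t x / x)\<^sup>\<alpha>\<close>. Hence \<open>x\<^sup>\<alpha> (1 - G x)\<close> is the truncated moment \<open>E (min X x)\<^sup>\<alpha>\<close>, and the layer
  cake formula turns it into a tail integral.\<close>

lemma powr_times_one_minus_G_transform:
  assumes \<alpha>: "\<alpha> > 0" and K: "nonneg_distribution_function K" and x: "x > 0"
  shows "set_integrable lborel {0<..<x} (\<lambda>s. \<alpha> * s powr (\<alpha> - 1) * (1 - K s))"
    and "(LINT s:{0<..<x}|lborel. \<alpha> * s powr (\<alpha> - 1) * (1 - K s)) = x powr \<alpha> * (1 - G_transform \<alpha> K x)"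
proof -
  note cdf = cdf_of[OF K]
  interpret real_distribution "interval_measure K"
    using K by (rule real_distribution_of)
  let ?g = "\<lambda>t. indicator {0..x} t * (1 - (t / x) powr \<alpha>)"
  let ?h = "\<lambda>t. min t x powr \<alpha>"
  have [measurable]: "K \<in> borel_measurable borel"
    using distribution_mono[OF K] by (rule borel_measurable_mono)
  have G: "G_transform \<alpha> K x = (LINT t|interval_measure K. ?g t)"
    by (simp add: G_transform_def set_lebesgue_integral_def)
  have h_le: "?h t \<le> x powr \<alpha>" if "0 \<le> t" for t
    using that \<alpha> x by (intro powr_mono2) auto
  have AE0: "AE t in interval_measure K. 0 \<le> t"
    using K by (rule AE_nonneg_of)
  have int_h: "integrable (interval_measure K) ?h"
    using AE0 h_le by (intro integrable_const_bound[where B = "x powr \<alpha>"]) auto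
  have "G_transform \<alpha> K x = (LINT t|interval_measure K. 1 - ?h t / x powr \<alpha>)"
    unfolding G
  proof (rule integral_cong_AE)
    show "AE t in interval_measure K. ?g t = 1 - ?h t / x powr \<alpha>"
      using AE0 x by (auto simp: indicator_def powr_divide min_def)
  qed auto
  also have "\<dots> = 1 - (LINT t|interval_measure K. ?h t) / x powr \<alpha>"
    using int_h prob_space by (subst Bochner_Integration.integral_diff) auto
  finally have h_eq: "(LINT t|interval_measure K. ?h t) = x powr \<alpha> * (1 - G_transform \<alpha> K x)"
    using x by (simp add: field_simps)
  have "(\<integral>\<^sup>+t. ?h t \<partial>interval_measure K) =
    (\<integral>\<^sup>+t. (\<integral>\<^sup>+s\<in>{0<..<t} \<inter> {..<x}. ennreal (\<alpha> * s powr (\<alpha> - 1)) \<partial>lborel) \<partial>interval_measure K)"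
  proof (rule nn_integral_cong_AE, use AE0 in eventually_elim)
    fix t :: real assume t: "0 \<le> t"
    have "{0<..<t} \<inter> {..<x} = {0<..<min t x}"
      by auto
    then show "ennreal (?h t) =
      (\<integral>\<^sup>+s\<in>{0<..<t} \<inter> {..<x}. ennreal (\<alpha> * s powr (\<alpha> - 1)) \<partial>lborel)"
      using t x \<alpha> by (simp add: nn_integral_powr_density)
  qed
  also have "\<dots> = (\<integral>\<^sup>+s\<in>{0<..<x}. ennreal (\<alpha> * s powr (\<alpha> - 1) * (1 - K s)) \<partial>lborel)"
    by (subst layer_cake_powr) (auto simp: cdf greaterThanLessThan_def)
  also have "\<dots> = (\<integral>\<^sup>+s. ennreal (indicator {0<..<x} s * (\<alpha> * s powr (\<alpha> - 1) * (1 - K s))) \<partial>lborel)"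
    by (intro nn_integral_cong) (auto simp: indicator_def)
  finally have "(\<integral>\<^sup>+s. ennreal (indicator {0<..<x} s * (\<alpha> * s powr (\<alpha> - 1) * (1 - K s))) \<partial>lborel) =
      ennreal (x powr \<alpha> * (1 - G_transform \<alpha> K x))"
    using nn_integral_eq_integral[OF int_h] by (simp add: h_eq)
  moreover have "0 \<le> x powr \<alpha> * (1 - G_transform \<alpha> K x)"
    unfolding h_eq[symmetric] by (intro integral_nonneg_AE) auto
  moreover have "0 \<le> indicator {0<..<x} s * (\<alpha> * s powr (\<alpha> - 1) * (1 - K s))" for s
    using \<alpha> distribution_le_1[OF K, of s] by (auto simp: indicator_def)
  ultimately have *: "integrable lborel (\<lambda>s. indicator {0<..<x} s * (\<alpha> * s powr (\<alpha> - 1) * (1 - K s))) \<and>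
    (LINT s|lborel. indicator {0<..<x} s * (\<alpha> * s powr (\<alpha> - 1) * (1 - K s))) = x powr \<alpha> * (1 - G_transform \<alpha> K x)"
    by (subst nn_integral_eq_integrable[symmetric]) auto
  show "set_integrable lborel {0<..<x} (\<lambda>s. \<alpha> * s powr (\<alpha> - 1) * (1 - K s))"
    using * by (simp add: set_integrable_def)
  show "(LINT s:{0<..<x}|lborel. \<alpha> * s powr (\<alpha> - 1) * (1 - K s)) = x powr \<alpha> * (1 - G_transform \<alpha> K x)"
    using * by (simp add: set_lebesgue_integral_def)
qed

text \<open>The complementary form of the previous identity: \<open>G x\<close> is the average of \<open>K\<close> over \<open>[0, x]\<close> with
  respect to the probability density \<open>\<alpha> s\<^bsup>\<alpha>-1\<^esup> / x\<^sup>\<alpha>\<close>. This is the description of the transform from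
  which \<open>K\<close> can be recovered by differentiation.\<close>

lemma has_integral_G_transform:
  assumes \<alpha>: "\<alpha> > 0" and K: "nonneg_distribution_function K" and x: "x \<ge> 0"
  shows "((\<lambda>s. \<alpha> * s powr (\<alpha> - 1) * K s) has_integral x powr \<alpha> * G_transform \<alpha> K x) {0..x}"
proof (cases "x = 0")
  case False
  with x have x: "x > 0" by simp
  note L = powr_times_one_minus_G_transform[OF \<alpha> K x]
  have "((\<lambda>s. \<alpha> * s powr (\<alpha> - 1) * (1 - K s)) has_integral x powr \<alpha> * (1 - G_transform \<alpha> K x)) {0<..<x}"
    using set_borel_integral_eq_integral[OF L(1)] L(2) by (simp add: has_integral_iff)
  then have "((\<lambda>s. \<alpha> * s powr (\<alpha> - 1) * (1 - K s)) has_integral x powr \<alpha> * (1 - G_transform \<alpha> K x)) {0..x}"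
    by (simp add: has_integral_Icc_iff_Ioo)
  moreover have "((\<lambda>s. \<alpha> * s powr (\<alpha> - 1)) has_integral x powr \<alpha>) {0..x}"
    using \<alpha> x by (intro has_integral_powr_density) auto
  ultimately have "((\<lambda>s. \<alpha> * s powr (\<alpha> - 1) - \<alpha> * s powr (\<alpha> - 1) * (1 - K s)) has_integral
      x powr \<alpha> - x powr \<alpha> * (1 - G_transform \<alpha> K x)) {0..x}"
    by (intro has_integral_diff)
  then show ?thesis
    by (simp add: algebra_simps)
qed auto

section \<open>Injectivity of the Williamson transform\<close>

text \<open>Differentiation within an interval, rather than at a point, covers two situations at once: the
  one-sided derivative at a jump of \<open>K\<close>, where only right-continuity is available, and the ordinary
  derivative at a continuity point.\<close>

lemma has_vector_derivative_G_transform: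
  assumes \<alpha>: "\<alpha> > 0" and K: "nonneg_distribution_function K"
    and x: "0 < x" "x \<in> {a..b}" "0 \<le> a" and cont: "continuous (at x within {a..b}) K"
  shows "((\<lambda>u. u powr \<alpha> * G_transform \<alpha> K u) has_vector_derivative \<alpha> * x powr (\<alpha> - 1) * K x)
           (at x within {a..b})"
proof -
  let ?w = "\<lambda>s. \<alpha> * s powr (\<alpha> - 1) * K s"
  note I = has_integral_G_transform[OF \<alpha> K]
  have int: "?w integrable_on {0..b}"
    using I[of b] x by auto
  have int_ab: "?w integrable_on {a..b}"
    using integrable_on_subinterval[OF int] x by auto
  have "isCont (\<lambda>s. \<alpha> * s powr (\<alpha> - 1)) x"
    using x by (auto intro!: continuous_intros)
  then have cont_powr: "continuous (at x within {a..b}) (\<lambda>s. \<alpha> * s powr (\<alpha> - 1))"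
    by (rule continuous_at_imp_continuous_at_within)
  have "((\<lambda>u. integral {a..u} ?w) has_vector_derivative ?w x) (at x within {a..b} - {})"
    using int_ab x continuous_mult[OF cont_powr cont]
    by (intro integral_has_vector_derivative_continuous_at) auto
  then have "((\<lambda>u. integral {a..u} ?w + a powr \<alpha> * G_transform \<alpha> K a)
      has_vector_derivative ?w x) (at x within {a..b})"
    by (simp add: has_vector_derivative_add_const)
  then show ?thesis
  proof (rule has_vector_derivative_transform[rotated 2])
    fix u assume u: "u \<in> {a..b}"
    have "integral {0..a} ?w + integral {a..u} ?w = integral {0..u} ?w"
      using u x I[of u] by (intro Henstock_Kurzweil_Integration.integral_combine) auto
    then show "u powr \<alpha> * G_transform \<alpha> K u = integral {a..u} ?w + a powr \<alpha> * G_transform \<alpha> K a"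
      using I[of a, THEN integral_unique] I[of u, THEN integral_unique] u x by simp
  qed (use x in auto)
qed

text \<open>The right derivative of \<open>u\<^sup>\<alpha> G u\<close> at \<open>x > 0\<close> is \<open>\<alpha> x\<^bsup>\<alpha>-1\<^esup> K x\<close>, so the transform determines \<open>K\<close> on the
  positive half-line; right-continuity then determines \<open>K 0\<close>, and the possible atom at \<open>0\<close> with it.\<close>

lemma G_transform_inject:
  assumes \<alpha>: "\<alpha> > 0"
    and K: "nonneg_distribution_function K1" "nonneg_distribution_function K2"
    and eq: "\<And>x. x > 0 \<Longrightarrow> G_transform \<alpha> K1 x = G_transform \<alpha> K2 x"
  shows "K1 = K2"
proof
  have pos: "K1 x = K2 x" if x: "x > 0" for x
  proof -
    let ?A = "at x within {x..x + 1}"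
    have cont: "continuous ?A K" if "nonneg_distribution_function K" for K
      using distribution_right_cont[OF that] by (simp add: at_within_Icc_at_right)
    have "((\<lambda>u. u powr \<alpha> * G_transform \<alpha> K1 u) has_vector_derivative \<alpha> * x powr (\<alpha> - 1) * K1 x) ?A"
      using x \<alpha> K cont by (intro has_vector_derivative_G_transform) auto
    moreover have "((\<lambda>u. u powr \<alpha> * G_transform \<alpha> K2 u) has_vector_derivative \<alpha> * x powr (\<alpha> - 1) * K2 x) ?A"
      using x \<alpha> K cont by (intro has_vector_derivative_G_transform) auto
    then have "((\<lambda>u. u powr \<alpha> * G_transform \<alpha> K1 u) has_vector_derivative \<alpha> * x powr (\<alpha> - 1) * K2 x) ?A"
      by (rule has_vector_derivative_transform[rotated 2]) (use x eq in auto)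
    ultimately have "\<alpha> * x powr (\<alpha> - 1) * K1 x = \<alpha> * x powr (\<alpha> - 1) * K2 x"
      by (rule vector_derivative_unique_within[rotated]) (auto simp: at_within_Icc_at_right)
    then show ?thesis
      using x \<alpha> by simp
  qed
  have "K1 0 = K2 0"
  proof -
    have "(K1 \<longlongrightarrow> K1 0) (at_right 0)" "(K2 \<longlongrightarrow> K2 0) (at_right 0)"
      using K[THEN distribution_right_cont, of 0] by (auto simp: continuous_within)
    moreover have "eventually (\<lambda>x. K1 x = K2 x) (at_right 0)"
      using pos by (auto simp: eventually_at_filter)
    then have "(K1 \<longlongrightarrow> K2 0) (at_right 0) \<longleftrightarrow> (K2 \<longlongrightarrow> K2 0) (at_right 0)"
      by (rule tendsto_cong)
    ultimately show ?thesis
      using tendsto_unique[OF trivial_limit_at_right_real] by blast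
  qed
  with pos show "K1 x = K2 x" for x
    using distribution_neg[OF K(1), of x] distribution_neg[OF K(2), of x]
    by (cases x "0 :: real" rule: linorder_cases) auto
qed

text \<open>Injectivity is exactly what the definite description behind the convolution needs: exhibiting one
  distribution function with the product transform identifies the convolution.\<close>

lemma kendall_conv_eqI:
  assumes "\<alpha> > 0" "nonneg_distribution_function K"
    and "\<And>x. x > 0 \<Longrightarrow> G_transform \<alpha> K x = G_transform \<alpha> F1 x * G_transform \<alpha> F2 x"
  shows "kendall_conv \<alpha> F1 F2 = K"
  unfolding kendall_conv_def
proof (rule the_equality)
  fix K' assume "nonneg_distribution_function K' \<and>
    (\<forall>x>0. G_transform \<alpha> K' x = G_transform \<alpha> F1 x * G_transform \<alpha> F2 x)"
  with assms show "K' = K"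
    by (intro G_transform_inject[of \<alpha>]) auto
qed (use assms in auto)

section \<open>Kendall powers of a continuous distribution function\<close>

lemma nonneg_distribution_function_point_mass:
  "nonneg_distribution_function (indicator {0..})"
proof -
  have mono: "mono (indicator {0..} :: real \<Rightarrow> real)"
    by (auto simp: mono_def split: split_indicator)
  have r: "continuous (at_right a) (indicator {0..} :: real \<Rightarrow> real)" for a :: real
  proof -
    have "eventually (\<lambda>x. indicator {0..} x = (indicator {0..} a :: real)) (at_right a)"
    proof (cases "a < 0")
      case True
      then show ?thesis
        using eventually_at_right_real[of a 0] by (auto elim!: eventually_mono)
    qed (auto simp: eventually_at_filter)
    then show ?thesis
      unfolding continuous_within by (rule tendsto_eventually)
  qed
  have bot: "eventually (\<lambda>x. indicator {0..} x = (0::real)) (at_bot :: real filter)"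
    using eventually_gt_at_bot[of "0::real"] by eventually_elim auto
  have top: "eventually (\<lambda>x. indicator {0..} x = (1::real)) (at_top :: real filter)"
    using eventually_ge_at_top[of "0::real"] by eventually_elim auto
  have left: "eventually (\<lambda>x. indicator {0..} x = (0::real)) (at_left (0::real))"
    by (auto simp: eventually_at_filter)
  show ?thesis
    unfolding nonneg_distribution_function_def
    using mono r tendsto_eventually[OF bot] tendsto_eventually[OF top] tendsto_eventually[OF left]
    by auto
qed

lemma G_transform_point_mass:
  assumes "\<alpha> > 0" "x > 0"
  shows "G_transform \<alpha> (indicator {0..}) x = 1"
proof -
  have "((\<lambda>s. \<alpha> * s powr (\<alpha> - 1) * indicator {0..} s) has_integral
      x powr \<alpha> * G_transform \<alpha> (indicator {0..}) x) {0..x}"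
    using assms by (intro has_integral_G_transform nonneg_distribution_function_point_mass) auto
  then have "((\<lambda>s. \<alpha> * s powr (\<alpha> - 1)) has_integral
      x powr \<alpha> * G_transform \<alpha> (indicator {0..}) x) {0..x}"
    by (rule has_integral_eq[rotated]) auto
  moreover have "((\<lambda>s. \<alpha> * s powr (\<alpha> - 1)) has_integral x powr \<alpha>) {0..x}"
    using assms by (intro has_integral_powr_density) auto
  ultimately have "x powr \<alpha> * G_transform \<alpha> (indicator {0..}) x = x powr \<alpha>"
    by (rule has_integral_unique)
  then show ?thesis
    using assms by simp
qed

lemma tendsto_G_transform_at_top:
  assumes \<alpha>: "\<alpha> > 0" and K: "nonneg_distribution_function K"
  shows "(G_transform \<alpha> K \<longlongrightarrow> 1) at_top"
proof -
  interpret real_distribution "interval_measure K"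
    using K by (rule real_distribution_of)
  let ?g = "\<lambda>x t. indicator {0..x} t * (1 - (t / x) powr \<alpha>)"
  have "((\<lambda>x. LINT t|interval_measure K. ?g x t) \<longlongrightarrow> (LINT t|interval_measure K. 1)) at_top"
  proof (rule integral_dominated_convergence_at_top[where w = "\<lambda>_. 1"])
    have "\<bar>?g x t\<bar> \<le> 1" for x t
      using G_kernel_bounds[OF \<alpha>, of x t] by (auto simp: indicator_def split: if_splits)
    then show "\<forall>\<^sub>F x in at_top. AE t in interval_measure K. norm (?g x t) \<le> 1"
      by (intro always_eventually allI AE_I2) auto
    have "AE t in interval_measure K. 0 \<le> t"
      using K by (rule AE_nonneg_of)
    then show "AE t in interval_measure K. ((\<lambda>x. ?g x t) \<longlongrightarrow> 1) at_top"
    proof eventually_elim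
      fix t :: real assume t: "0 \<le> t"
      have "((\<lambda>x. t / x) \<longlongrightarrow> 0) at_top"
        by (intro tendsto_divide_0[OF tendsto_const] filterlim_at_top_imp_at_infinity filterlim_ident)
      then have "((\<lambda>x. (t / x) powr \<alpha>) \<longlongrightarrow> 0) at_top"
      proof (rule tendsto_zero_powrI)
        show "\<forall>\<^sub>F x in at_top. 0 \<le> t / x"
          using eventually_gt_at_top[of 0] by eventually_elim (use t in auto)
      qed (use \<alpha> in auto)
      then have "((\<lambda>x. 1 - (t / x) powr \<alpha>) \<longlongrightarrow> 1 - 0) at_top"
        by (intro tendsto_intros)
      moreover have "eventually (\<lambda>x. 1 - (t / x) powr \<alpha> = ?g x t) at_top"
        using eventually_ge_at_top[of t] by eventually_elim (use t in auto)
      ultimately show "((\<lambda>x. ?g x t) \<longlongrightarrow> 1) at_top"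
        using Lim_transform_eventually by fastforce
    qed
  qed auto
  then show ?thesis
    using prob_space by (simp add: G_transform_def[abs_def] set_lebesgue_integral_def)
qed

text \<open>The convex function \<open>t \<mapsto> t\<^bsup>n+1\<^esup>\<close> lies above its tangent line at \<open>g\<close>, with the terms arranged for the
  monotonicity proof below.\<close>

lemma power_tangent_line_bound:
  fixes g h :: real
  assumes "0 \<le> g" "g \<le> h"
  shows "real (Suc n) * h * g ^ n \<le> h ^ Suc n + real n * g ^ Suc n"
proof (induction n)
  case (Suc n)
  have "0 \<le> h * (h ^ Suc n + real n * g ^ Suc n - real (Suc n) * h * g ^ n)
     + real (Suc n) * g ^ n * (h - g)\<^sup>2"
    using Suc assms by (intro add_nonneg_nonneg mult_nonneg_nonneg) auto
  then show ?case
    by (simp add: algebra_simps power2_eq_square)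
qed simp

text \<open>This is the reason why the explicit Kendall powers below are nondecreasing. Formally, the
  differential of \<open>g\<^sup>n ((n + 1) f - n g)\<close> is \<open>n (n + 1) g\<^bsup>n-1\<^esup> (f - g) dg + (n + 1) g\<^sup>n df\<close>, which is
  nonnegative where \<open>g \<le> f\<close>; but \<open>F\<close> need not be differentiable, so finite increments are used instead. The
  intermediate value \<open>max f h\<close> splits the increment into a part where only \<open>f\<close> grows, one where only \<open>g\<close>
  grows to \<open>h\<close> (controlled by the tangent line bound), and again one where only \<open>f\<close> grows.\<close>

lemma kendall_power_formula_mono:
  fixes f f' g h :: real
  assumes "0 \<le> g" "g \<le> h" "f \<le> f'" "h \<le> f'"
  shows "g ^ n * (f + real n * (f - g)) \<le> h ^ n * (f' + real n * (f' - h))"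
proof -
  define M where "M = max f h"
  have gh: "g ^ n \<le> h ^ n" "0 \<le> g ^ n" "0 \<le> h ^ n"
    using assms by (auto intro: power_mono)
  have "g ^ n * (real (Suc n) * f - n * g) \<le> g ^ n * (real (Suc n) * M - n * g)"
    using gh by (intro mult_left_mono diff_right_mono) (auto simp: M_def)
  also have "\<dots> \<le> h ^ n * (real (Suc n) * M - n * h)"
  proof -
    have "real (Suc n) * h * (h ^ n - g ^ n) \<le> real (Suc n) * M * (h ^ n - g ^ n)"
      using gh by (intro mult_right_mono mult_left_mono) (auto simp: M_def)
    with power_tangent_line_bound[OF assms(1,2), of n] show ?thesis
      by (simp add: algebra_simps)
  qed
  also have "\<dots> \<le> h ^ n * (real (Suc n) * f' - n * h)"
    using gh assms by (intro mult_left_mono diff_right_mono) (auto simp: M_def)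
  finally show ?thesis
    by (simp add: algebra_simps)
qed

text \<open>Continuity of \<open>F\<close> at \<open>0\<close> excludes an atom there, and continuity at \<open>x > 0\<close> makes the transform
  differentiable at \<open>x\<close> with \<open>x G' x = \<alpha> (F x - G x)\<close>.\<close>

locale continuous_kendall =
  fixes \<alpha> :: real and F :: "real \<Rightarrow> real"
  assumes alpha_pos: "\<alpha> > 0"
    and F_distr: "nonneg_distribution_function F"
    and isCont_F: "\<And>x. isCont F x"
begin

abbreviation G :: "real \<Rightarrow> real" where "G \<equiv> G_transform \<alpha> F"

lemmas F_le_1 = distribution_le_1[OF F_distr]
  and F_mono = distribution_mono[OF F_distr, THEN monoD]
  and G_nonneg = G_transform_bounds(1)[OF alpha_pos F_distr]
  and G_le_F = G_transform_bounds(2)[OF alpha_pos F_distr]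

lemma F_eq_0: "F x = 0" if "x \<le> 0"
proof (cases "x = 0")
  case True
  have "(F \<longlongrightarrow> 0) (at_left 0)"
    using F_distr by (auto simp: nonneg_distribution_function_def)
  moreover have "(F \<longlongrightarrow> F 0) (at_left 0)"
    using isCont_F[of 0] by (auto simp: isCont_def intro: tendsto_within_subset)
  ultimately show ?thesis
    using tendsto_unique[OF trivial_limit_at_left_real] True by blast
qed (use distribution_neg[OF F_distr] that in auto)

lemma G_eq_0: "G x = 0" if "x \<le> 0"
  using G_nonneg[of x] G_le_F[of x] F_eq_0[OF that] by simp

lemma powr_mult_G_has_real_derivative:
  assumes "x > 0"
  shows "((\<lambda>u. u powr \<alpha> * G u) has_real_derivative \<alpha> * x powr (\<alpha> - 1) * F x) (at x)"
proof -
  have "((\<lambda>u. u powr \<alpha> * G u) has_vector_derivative \<alpha> * x powr (\<alpha> - 1) * F x) (at x within {0..x + 1})"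
    using assms isCont_F[of x] alpha_pos F_distr
    by (intro has_vector_derivative_G_transform) (auto intro: continuous_at_imp_continuous_within)
  then show ?thesis
    using assms by (simp add: at_within_Icc_at has_real_derivative_iff_has_vector_derivative)
qed

lemma G_has_real_derivative:
  assumes x: "x > 0"
  shows "(G has_real_derivative \<alpha> * (F x - G x) / x) (at x)"
proof -
  have "((\<lambda>u. u powr (- \<alpha>) * (u powr \<alpha> * G u)) has_real_derivative
      (- \<alpha> * x powr (- \<alpha> - 1)) * (x powr \<alpha> * G x) + (\<alpha> * x powr (\<alpha> - 1) * F x) * x powr (- \<alpha>)) (at x)"
    using x by (intro DERIV_mult powr_mult_G_has_real_derivative)
      (auto intro!: derivative_eq_intros)
  also have "(- \<alpha> * x powr (- \<alpha> - 1)) * (x powr \<alpha> * G x) + (\<alpha> * x powr (\<alpha> - 1) * F x) * x powr (- \<alpha>) =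
      \<alpha> * (F x - G x) / x"
    using x by (simp add: powr_diff powr_minus field_simps)
  finally show ?thesis
  proof (rule DERIV_cong_ev[THEN iffD1, rotated 3])
    show "\<forall>\<^sub>F u in nhds x. u powr (- \<alpha>) * (u powr \<alpha> * G u) = G u"
      using eventually_nhds_in_open[of "{0<..}" x] x
      by (auto elim!: eventually_mono simp: powr_minus)
  qed auto
qed

lemma G_mono: "G x \<le> G y" if "x \<le> y"
proof (cases "x > 0")
  case True
  show ?thesis
  proof (rule DERIV_nonneg_imp_nondecreasing[OF that])
    fix u assume "x \<le> u"
    with True have "u > 0" by simp
    then show "\<exists>d. (G has_real_derivative d) (at u) \<and> 0 \<le> d"
      using G_has_real_derivative[of u] G_le_F[of u] alpha_pos
      by (intro exI[of _ "\<alpha> * (F u - G u) / u"]) auto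
  qed
qed (use G_eq_0 G_nonneg in auto)

lemma isCont_G: "isCont G x"
proof (cases x "0 :: real" rule: linorder_cases)
  case equal
  have "(F \<longlongrightarrow> 0) (at 0)"
    using isCont_F[of 0] F_eq_0[of 0] by (simp add: isCont_def)
  then have "(G \<longlongrightarrow> 0) (at 0)"
    by (rule tendsto_sandwich[OF _ _ tendsto_const, rotated 2]) (simp_all add: G_nonneg G_le_F)
  then show ?thesis
    using equal G_eq_0[of 0] by (simp add: isCont_def)
next
  case less
  have "eventually (\<lambda>u. G u = 0) (nhds x)"
    using eventually_nhds_in_open[of "{..<0}" x] less by (auto elim!: eventually_mono simp: G_eq_0)
  then show ?thesis
    by (subst isCont_cong) auto
next
  case greater
  then show ?thesis
    using G_has_real_derivative DERIV_isCont by blast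
qed

text \<open>Inverting the transform by the rule \<open>F = G + x G' / \<alpha>\<close> with \<open>G\<^bsup>n+1\<^esup>\<close> in place of \<open>G\<close> gives
  \<open>G\<^bsup>n+1\<^esup> + (n + 1) G\<^sup>n (F - G) = G\<^sup>n (F + n (F - G))\<close>. The index is shifted so that \<open>n = 0\<close> gives \<open>F\<close>
  itself: the point mass at \<open>0\<close> is discontinuous and does not fit the formula on the negative
  half-line.\<close>

definition power_cdf :: "nat \<Rightarrow> real \<Rightarrow> real" where
  "power_cdf n x = G x ^ n * (F x + real n * (F x - G x))"

lemma power_cdf_eq_0: "power_cdf n x = 0" if "x \<le> 0"
  using that by (simp add: power_cdf_def F_eq_0 G_eq_0)

lemma nonneg_distribution_function_power_cdf: "nonneg_distribution_function (power_cdf n)"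
  unfolding nonneg_distribution_function_def
proof (intro conjI allI)
  show "mono (power_cdf n)"
    unfolding power_cdf_def
    by (intro monoI kendall_power_formula_mono G_nonneg G_mono F_mono G_le_F)
  have "isCont (power_cdf n) a" for a
    unfolding power_cdf_def[abs_def] by (intro continuous_intros isCont_F isCont_G)
  then show "continuous (at_right a) (power_cdf n)" for a
    by (rule continuous_at_imp_continuous_at_within)
  have "eventually (\<lambda>x. power_cdf n x = 0) at_bot"
    using eventually_le_at_bot[of 0] by eventually_elim (rule power_cdf_eq_0)
  then show "(power_cdf n \<longlongrightarrow> 0) at_bot"
    by (rule tendsto_eventually)
  have "((\<lambda>x. G x ^ n * (F x + real n * (F x - G x))) \<longlongrightarrow> 1 ^ n * (1 + real n * (1 - 1))) at_top"
    using distribution_at_top[OF F_distr]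
      tendsto_G_transform_at_top[OF alpha_pos F_distr] by (intro tendsto_intros)
  then show "(power_cdf n \<longlongrightarrow> 1) at_top"
    by (simp add: power_cdf_def[abs_def])
  have "eventually (\<lambda>x. power_cdf n x = 0) (at_left 0)"
    by (auto simp: eventually_at_filter power_cdf_eq_0)
  then show "(power_cdf n \<longlongrightarrow> 0) (at_left 0)"
    by (rule tendsto_eventually)
qed

text \<open>The function \<open>u\<^sup>\<alpha> G\<^bsup>n+1\<^esup>\<close> is a primitive of \<open>\<alpha> u\<^bsup>\<alpha>-1\<^esup>\<close> times the candidate, continuous up to \<open>0\<close> even when
  the integrand is unbounded there, so the fundamental theorem of calculus with an interior derivative
  applies and its value is compared with the weighted-average form of the transform.\<close>

lemma G_transform_power_cdf:
  assumes x: "x > 0"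
  shows "G_transform \<alpha> (power_cdf n) x = G x ^ Suc n"
proof -
  \<comment> \<open>The factor \<open>u\<^sup>\<alpha> G u\<close> is kept together: its derivative is known without differentiating \<open>u\<^sup>\<alpha>\<close> separately.\<close>
  have "((\<lambda>s. \<alpha> * s powr (\<alpha> - 1) * power_cdf n s) has_integral
      (x powr \<alpha> * G x) * G x ^ n - (0 powr \<alpha> * G 0) * G 0 ^ n) {0..x}"
  proof (rule fundamental_theorem_of_calculus_interior)
    show "continuous_on {0..x} (\<lambda>u. (u powr \<alpha> * G u) * G u ^ n)"
      using alpha_pos isCont_G
      by (intro continuous_intros continuous_on_powr') (auto intro: continuous_at_imp_continuous_on)
    fix u assume "u \<in> {0<..<x}"
    then have u: "u > 0" by simp
    have "((\<lambda>u. (u powr \<alpha> * G u) * G u ^ n) has_real_derivative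
       (\<alpha> * u powr (\<alpha> - 1) * F u) * G u ^ n
         + (real n * G u ^ (n - 1) * (\<alpha> * (F u - G u) / u)) * (u powr \<alpha> * G u)) (at u)"
      using powr_mult_G_has_real_derivative[OF u] G_has_real_derivative[OF u]
      by (intro DERIV_mult DERIV_power[THEN DERIV_cong]) auto
    also have "(\<alpha> * u powr (\<alpha> - 1) * F u) * G u ^ n
         + (real n * G u ^ (n - 1) * (\<alpha> * (F u - G u) / u)) * (u powr \<alpha> * G u)
       = \<alpha> * u powr (\<alpha> - 1) * power_cdf n u"
      using u by (cases n) (simp_all add: power_cdf_def powr_diff field_simps)
    finally show "((\<lambda>u. (u powr \<alpha> * G u) * G u ^ n) has_vector_derivative
        \<alpha> * u powr (\<alpha> - 1) * power_cdf n u) (at u)"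
      by (simp add: has_real_derivative_iff_has_vector_derivative)
  qed (use x in auto)
  moreover have "((\<lambda>s. \<alpha> * s powr (\<alpha> - 1) * power_cdf n s) has_integral
      x powr \<alpha> * G_transform \<alpha> (power_cdf n) x) {0..x}"
    using x by (intro has_integral_G_transform alpha_pos nonneg_distribution_function_power_cdf) auto
  ultimately have "(x powr \<alpha> * G x) * G x ^ n - (0 powr \<alpha> * G 0) * G 0 ^ n =
      x powr \<alpha> * G_transform \<alpha> (power_cdf n) x"
    by (rule has_integral_unique)
  then show ?thesis
    using x by simp
qed

lemma kendall_power_Suc: "kendall_power \<alpha> F (Suc n) = power_cdf n"
proof (induction n)
  case 0
  have "kendall_conv \<alpha> (indicator {0..}) F = power_cdf 0"
    using alpha_pos by (intro kendall_conv_eqI nonneg_distribution_function_power_cdf)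
      (simp_all add: G_transform_power_cdf G_transform_point_mass)
  then show ?case by simp
next
  case (Suc n)
  have "kendall_conv \<alpha> (power_cdf n) F = power_cdf (Suc n)"
    using alpha_pos by (intro kendall_conv_eqI nonneg_distribution_function_power_cdf)
      (simp_all add: G_transform_power_cdf)
  with Suc show ?case
    by simp
qed

section \<open>The Kendall renewal function in closed form\<close>

text \<open>Summing \<open>G\<^sup>n\<close> and \<open>(n + 1) G\<^sup>n\<close> over \<open>n\<close> gives the geometric series and its derivative. The result
  depends on \<open>F\<close> only through the tails of \<open>F\<close> and of \<open>G\<close> at the same point.\<close>

lemma kendall_renewal_eq:
  assumes x: "x \<ge> 0" and F: "F x < 1"
  shows "kendall_renewal \<alpha> F x = 2 / (1 - G x) - (1 - F x) / (1 - G x)\<^sup>2"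
proof -
  have G1: "G x < 1"
    using G_le_F[of x] F by linarith
  have n: "norm (G x) < 1"
    using G1 G_nonneg[of x] by simp
  have "(\<lambda>n. (real (Suc n) * G x ^ n) * (F x - G x) + G x ^ n * G x) sums
      (1 / (1 - G x)\<^sup>2 * (F x - G x) + 1 / (1 - G x) * G x)"
    using geometric_deriv_sums[OF n] geometric_sums[OF n]
    by (intro sums_add sums_mult2) auto
  also have "(\<lambda>n. (real (Suc n) * G x ^ n) * (F x - G x) + G x ^ n * G x) =
      (\<lambda>n. kendall_power \<alpha> F (Suc n) x)"
    unfolding kendall_power_Suc power_cdf_def by (simp add: fun_eq_iff algebra_simps)
  finally have "(\<lambda>n. kendall_power \<alpha> F n x) sums
      (1 / (1 - G x)\<^sup>2 * (F x - G x) + 1 / (1 - G x) * G x + kendall_power \<alpha> F 0 x)"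
    by (rule sums_Suc)
  then have "kendall_renewal \<alpha> F x = 1 / (1 - G x)\<^sup>2 * (F x - G x) + 1 / (1 - G x) * G x + 1"
    using x by (simp add: kendall_renewal_def sums_iff)
  also have "\<dots> = 2 / (1 - G x) - (1 - F x) / (1 - G x)\<^sup>2"
  proof -
    define d where "d = 1 - G x"
    have d: "d \<noteq> 0" and G: "G x = 1 - d"
      using G1 by (auto simp: d_def)
    show ?thesis
      using d unfolding G by (simp add: field_simps power2_eq_square)
  qed
  finally show ?thesis .
qed

end

section \<open>Karamata's theorem for monotone functions\<close>

lemma set_lebesgue_integral_powr_to_inf:
  fixes e :: real
  assumes e: "e < -1"
  shows "set_integrable lborel {1..} (\<lambda>s. s powr e)"
    and "(LINT s:{1..}|lborel. s powr e) = 1 / (- e - 1)"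
proof -
  let ?f = "\<lambda>s :: real. indicator {1..} s * s powr e"
  have "((\<lambda>s. s powr e) has_integral - (1 powr (e + 1)) / (e + 1)) {1..}"
    using e by (intro has_integral_powr_to_inf) auto
  then have "(?f has_integral - 1 / (e + 1)) UNIV"
    by (subst (asm) has_integral_restrict_UNIV[symmetric])
       (auto elim!: has_integral_eq[rotated] simp: indicator_def)
  then have "integral\<^sup>N lborel ?f = ennreal (- 1 / (e + 1))"
    by (intro nn_integral_has_integral_lborel) auto
  moreover have "0 \<le> - 1 / (e + 1)"
    using e by (simp add: divide_nonpos_neg)
  ultimately have *: "integrable lborel ?f \<and> integral\<^sup>L lborel ?f = - 1 / (e + 1)"
    by (subst nn_integral_eq_integrable[symmetric]) auto
  moreover have "- 1 / (e + 1) = 1 / (- e - 1)"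
    using e by (simp add: divide_simps)
  ultimately show "set_integrable lborel {1..} (\<lambda>s. s powr e)"
    and "(LINT s:{1..}|lborel. s powr e) = 1 / (- e - 1)"
    by (simp_all add: set_integrable_def set_lebesgue_integral_def)
qed

text \<open>A Potter bound, which in general rests on the uniform convergence theorem for regularly varying
  functions. For a monotone function the limit along \<open>t = 2\<close> alone suffices: eventually each doubling
  of the argument costs a factor at most \<open>2\<^bsup>-\<gamma>\<^esup>\<close>, because \<open>\<gamma> < \<beta>\<close>, and monotonicity interpolates between
  powers of \<open>2\<close> at the price of the constant \<open>2\<^sup>\<gamma>\<close>.\<close>

lemma Potter_bound_antimono:
  fixes f :: "real \<Rightarrow> real"
  assumes f: "f \<in> RV (- \<beta>)" and antimono: "\<And>x y. 0 < x \<Longrightarrow> x \<le> y \<Longrightarrow> f y \<le> f x"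
    and \<gamma>: "0 \<le> \<gamma>" "\<gamma> < \<beta>"
  obtains x0 where "x0 > 0"
    and "\<And>x s. x0 \<le> x \<Longrightarrow> 1 \<le> s \<Longrightarrow> f (x * s) \<le> 2 powr \<gamma> * s powr (- \<gamma>) * f x"
proof -
  have pos: "f x > 0" if "x > 0" for x
    using f that by (simp add: RV_def)
  have "((\<lambda>x. f (2 * x) / f x) \<longlongrightarrow> 2 powr (- \<beta>)) at_top"
    using f by (simp add: RV_def)
  moreover have "(2 :: real) powr (- \<beta>) < 2 powr (- \<gamma>)"
    using \<gamma> by simp
  ultimately have "eventually (\<lambda>x. f (2 * x) / f x < 2 powr (- \<gamma>)) at_top"
    by (rule order_tendstoD)
  then obtain x1 where x1: "\<And>x. x1 \<le> x \<Longrightarrow> f (2 * x) / f x < 2 powr (- \<gamma>)"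
    by (auto simp: eventually_at_top_linorder)
  define x0 where "x0 = max x1 1"
  have "x0 > 0"
    by (simp add: x0_def)
  have double: "f (2 * x) \<le> 2 powr (- \<gamma>) * f x" if "x0 \<le> x" for x
    using x1[of x] that pos[of x] by (simp add: x0_def divide_simps)
  have bound: "f (x * s) \<le> 2 powr \<gamma> * s powr (- \<gamma>) * f x"
    if "1 \<le> s" "s \<le> 2 ^ n" "x0 \<le> x" for x s :: real and n :: nat
    using that
  proof (induction n arbitrary: x s)
    case 0
    then have "s = 1" by simp
    then show ?case
      using \<gamma> pos[of x] 0 \<open>x0 > 0\<close> by (simp add: ge_one_powr_ge_zero)
  next
    case (Suc n)
    have x: "x > 0"
      using Suc.prems \<open>x0 > 0\<close> by simp
    show ?case
    proof (cases "s \<le> 2")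
      case True
      have "f (x * s) \<le> f x"
        using x Suc.prems by (intro antimono) auto
      also have "1 \<le> (2 / s) powr \<gamma>"
        using True Suc.prems \<gamma> by (intro ge_one_powr_ge_zero) auto
      then have "f x \<le> (2 / s) powr \<gamma> * f x"
        using pos[OF x] by simp
      finally show ?thesis
        using Suc.prems by (simp add: powr_divide powr_minus field_simps)
    next
      case False
      have "f (x * s) = f ((2 * x) * (s / 2))"
        by simp
      also have "\<dots> \<le> 2 powr \<gamma> * (s / 2) powr (- \<gamma>) * f (2 * x)"
        using Suc.prems False x by (intro Suc.IH) auto
      also have "\<dots> \<le> 2 powr \<gamma> * (s / 2) powr (- \<gamma>) * (2 powr (- \<gamma>) * f x)"
        using Suc.prems by (intro mult_left_mono double) auto
      also have "\<dots> = 2 powr \<gamma> * s powr (- \<gamma>) * f x"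
        using Suc.prems by (simp add: powr_divide powr_minus field_simps)
      finally show ?thesis .
    qed
  qed
  show ?thesis
  proof (rule that[OF \<open>x0 > 0\<close>])
    fix x s :: real assume "x0 \<le> x" "1 \<le> s"
    obtain n where "s < 2 ^ n"
      using real_arch_pow[of 2 s] by auto
    then show "f (x * s) \<le> 2 powr \<gamma> * s powr (- \<gamma>) * f x"
      using bound[of s n x] \<open>x0 \<le> x\<close> \<open>1 \<le> s\<close> by simp
  qed
qed

text \<open>After the substitution \<open>y = x s\<close> the quotient is \<open>\<integral>\<^bsub>1\<^esub>\<^bsup>\<infinity>\<^esup> s\<^bsup>\<alpha>-1\<^esup> f (x s) / f x ds\<close>, whose integrand converges
  to \<open>s\<^bsup>\<alpha>-1-\<beta>\<^esup>\<close>. The Potter bound with an exponent strictly between \<open>\<alpha>\<close> and \<open>\<beta>\<close> provides an integrable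
  majorant.\<close>

lemma Karamata_tail_integral:
  fixes f :: "real \<Rightarrow> real"
  assumes f: "f \<in> RV (- \<beta>)" and antimono: "\<And>x y. 0 < x \<Longrightarrow> x \<le> y \<Longrightarrow> f y \<le> f x"
    and \<alpha>: "0 \<le> \<alpha>" "\<alpha> < \<beta>"
  shows "((\<lambda>x. (LINT y:{x..}|lborel. y powr (\<alpha> - 1) * f y) / (x powr \<alpha> * f x)) \<longlongrightarrow> 1 / (\<beta> - \<alpha>)) at_top"
proof -
  define \<gamma> where "\<gamma> = (\<alpha> + \<beta>) / 2"
  have \<gamma>: "0 \<le> \<gamma>" "\<gamma> < \<beta>" "\<alpha> < \<gamma>"
    using \<alpha> by (auto simp: \<gamma>_def)
  obtain x0 where x0: "x0 > 0"
    and Potter: "\<And>x s. x0 \<le> x \<Longrightarrow> 1 \<le> s \<Longrightarrow> f (x * s) \<le> 2 powr \<gamma> * s powr (- \<gamma>) * f x"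
    using Potter_bound_antimono[OF f antimono \<gamma>(1,2)] by blast
  have pos: "f x > 0" if "x > 0" for x
    using f that by (simp add: RV_def)
  \<comment> \<open>Membership in \<open>RV\<close> gives measurability on the positive half-line only, hence the truncation.\<close>
  define g where "g = (\<lambda>y. indicator {0<..} y * f y)"
  have [measurable]: "g \<in> borel_measurable borel"
    using f by (simp add: RV_def g_def set_borel_measurable_def)
  define u where "u = (\<lambda>x s. indicator {1..} s * (s powr (\<alpha> - 1) * (g (x * s) / f x)))"
  define v where "v = (\<lambda>s :: real. indicator {1..} s * s powr (\<alpha> - 1 - \<beta>))"
  have "((\<lambda>x. LINT s|lborel. u x s) \<longlongrightarrow> (LINT s|lborel. v s)) at_top"
  proof (rule integral_dominated_convergence_at_top
      [where w = "\<lambda>s. indicator {1..} s * s powr (\<alpha> - 1 - \<gamma>) * 2 powr \<gamma>"])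
    show "integrable lborel (\<lambda>s. indicator {1..} s * s powr (\<alpha> - 1 - \<gamma>) * 2 powr \<gamma>)"
      using set_lebesgue_integral_powr_to_inf(1)[of "\<alpha> - 1 - \<gamma>"] \<gamma>
      by (intro integrable_mult_left) (simp add: set_integrable_def)
    show "AE s in lborel. ((\<lambda>x. u x s) \<longlongrightarrow> v s) at_top"
    proof (rule AE_I2)
      fix s :: real
      show "((\<lambda>x. u x s) \<longlongrightarrow> v s) at_top"
      proof (cases "1 \<le> s")
        case True
        have "((\<lambda>x. f (s * x) / f x) \<longlongrightarrow> s powr (- \<beta>)) at_top"
          using f True by (simp add: RV_def)
        then have "((\<lambda>x. s powr (\<alpha> - 1) * (f (s * x) / f x)) \<longlongrightarrow> s powr (\<alpha> - 1) * s powr (- \<beta>)) at_top"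
          by (intro tendsto_intros)
        moreover have "s powr (\<alpha> - 1) * s powr (- \<beta>) = v s"
          using True by (simp add: v_def flip: powr_add)
        moreover have "eventually (\<lambda>x. s powr (\<alpha> - 1) * (f (s * x) / f x) = u x s) at_top"
          using eventually_gt_at_top[of 0]
          by eventually_elim (use True in \<open>auto simp: u_def g_def mult.commute\<close>)
        ultimately show ?thesis
          using Lim_transform_eventually by fastforce
      qed (auto simp: u_def v_def)
    qed
    show "\<forall>\<^sub>F x in at_top. AE s in lborel. norm (u x s) \<le> indicator {1..} s * s powr (\<alpha> - 1 - \<gamma>) * 2 powr \<gamma>"
      using eventually_ge_at_top[of x0]
    proof eventually_elim
      fix x assume x: "x0 \<le> x"
      have "norm (u x s) \<le> indicator {1..} s * s powr (\<alpha> - 1 - \<gamma>) * 2 powr \<gamma>" for s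
      proof (cases "1 \<le> s")
        case True
        have fx: "f x > 0" "f (x * s) > 0"
          using x x0 True by (auto intro!: pos)
        have "norm (u x s) = s powr (\<alpha> - 1) * (f (x * s) / f x)"
          using True x x0 fx by (simp add: u_def g_def)
        also have "\<dots> \<le> s powr (\<alpha> - 1) * (2 powr \<gamma> * s powr (- \<gamma>))"
          using Potter[OF x True] fx by (intro mult_left_mono) (auto simp: field_simps)
        also have "\<dots> = s powr (\<alpha> - 1 - \<gamma>) * 2 powr \<gamma>"
          using powr_add[of s "\<alpha> - 1" "- \<gamma>"] by simp
        finally show ?thesis
          using True by simp
      qed (simp add: u_def)
      then show "AE s in lborel. norm (u x s) \<le> indicator {1..} s * s powr (\<alpha> - 1 - \<gamma>) * 2 powr \<gamma>"
        by simp
    qed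
  qed (unfold u_def v_def, measurable)
  also have "(LINT s|lborel. v s) = 1 / (\<beta> - \<alpha>)"
    using set_lebesgue_integral_powr_to_inf(2)[of "\<alpha> - 1 - \<beta>"] \<alpha>
    by (simp add: v_def set_lebesgue_integral_def)
  finally have "((\<lambda>x. LINT s|lborel. u x s) \<longlongrightarrow> 1 / (\<beta> - \<alpha>)) at_top" .
  moreover have "eventually (\<lambda>x. (LINT s|lborel. u x s) =
      (LINT y:{x..}|lborel. y powr (\<alpha> - 1) * f y) / (x powr \<alpha> * f x)) at_top"
    using eventually_gt_at_top[of 0]
  proof eventually_elim
    fix x :: real assume x: "0 < x"
    have "(LINT y:{x..}|lborel. y powr (\<alpha> - 1) * f y) =
        x * (LINT s|lborel. indicator {x..} (x * s) * ((x * s) powr (\<alpha> - 1) * f (x * s)))"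
      using x unfolding set_lebesgue_integral_def
      by (subst lborel_integral_real_affine[where c = x and t = 0]) auto
    also have "(\<lambda>s. indicator {x..} (x * s) * ((x * s) powr (\<alpha> - 1) * f (x * s))) =
        (\<lambda>s. (x powr (\<alpha> - 1) * f x) * u x s)"
      using x pos[OF x] by (auto simp: fun_eq_iff u_def g_def indicator_def powr_mult)
    also have "x * (LINT s|lborel. (x powr (\<alpha> - 1) * f x) * u x s) =
        (x powr \<alpha> * f x) * (LINT s|lborel. u x s)"
      using x by (simp add: powr_diff)
    finally show "(LINT s|lborel. u x s) =
        (LINT y:{x..}|lborel. y powr (\<alpha> - 1) * f y) / (x powr \<alpha> * f x)"
      using x pos[OF x] by simp
  qed
  ultimately show ?thesis
    by (rule Lim_transform_eventually)
qed

section \<open>Asymptotic expansion of the renewal function\<close>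

context continuous_kendall
begin

text \<open>Splitting the moment integral at \<open>x\<close>: the truncated moment \<open>x\<^sup>\<alpha> (1 - G x)\<close> falls short of the full
  moment by \<open>\<alpha>\<close> times the weighted tail.\<close>

lemma powr_mult_one_minus_G:
  assumes int: "set_integrable lborel {0<..} (\<lambda>s. \<alpha> * s powr (\<alpha> - 1) * (1 - F s))" and x: "x > 0"
  shows "x powr \<alpha> * (1 - G x) =
    (LINT s:{0<..}|lborel. \<alpha> * s powr (\<alpha> - 1) * (1 - F s)) - \<alpha> * W_bar \<alpha> F x"
proof -
  let ?f = "\<lambda>s. \<alpha> * s powr (\<alpha> - 1) * (1 - F s)"
  have "(LINT s:{0<..}|lborel. ?f s) = (LINT s:{0<..<x} \<union> {x..}|lborel. ?f s)"
    using x by (intro arg_cong[where f = "\<lambda>A. LINT s:A|lborel. ?f s"]) auto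
  also have "\<dots> = (LINT s:{0<..<x}|lborel. ?f s) + (LINT s:{x..}|lborel. ?f s)"
    using x by (intro set_integral_Un set_integrable_subset[OF int]) auto
  also have "(LINT s:{0<..<x}|lborel. ?f s) = x powr \<alpha> * (1 - G x)"
    using x by (intro powr_times_one_minus_G_transform alpha_pos F_distr)
  also have "(LINT s:{x..}|lborel. ?f s) = \<alpha> * W_bar \<alpha> F x"
    by (simp add: W_bar_def mult.assoc)
  finally show ?thesis by simp
qed

lemma tendsto_W_bar:
  assumes int: "set_integrable lborel {0<..} (\<lambda>s. \<alpha> * s powr (\<alpha> - 1) * (1 - F s))"
  shows "(W_bar \<alpha> F \<longlongrightarrow> 0) at_top"
proof -
  let ?w = "\<lambda>s. indicator {0<..} s * (\<alpha> * s powr (\<alpha> - 1) * (1 - F s))"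
  let ?f = "\<lambda>x s. indicator {x..} s * (\<alpha> * s powr (\<alpha> - 1) * (1 - F s))"
  have [measurable]: "F \<in> borel_measurable borel"
    by (intro borel_measurable_mono monoI F_mono)
  have "((\<lambda>x. LINT s|lborel. ?f x s) \<longlongrightarrow> (LINT s|(lborel :: real measure). 0)) at_top"
  proof (rule integral_dominated_convergence_at_top[where w = ?w])
    show "integrable lborel ?w"
      using int by (simp add: set_integrable_def)
    show "\<forall>\<^sub>F x in at_top. AE s in lborel. norm (?f x s) \<le> ?w s"
      using eventually_gt_at_top[of 0]
    proof eventually_elim
      fix x :: real assume "x > 0"
      then show "AE s in lborel. norm (?f x s) \<le> ?w s"
        using alpha_pos F_le_1 by (intro AE_I2) (auto simp: indicator_def abs_mult)
    qed
    show "AE s in lborel. ((\<lambda>x. ?f x s) \<longlongrightarrow> 0) at_top"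
    proof (rule AE_I2)
      fix s :: real
      have "eventually (\<lambda>x. ?f x s = 0) at_top"
        using eventually_gt_at_top[of s] by eventually_elim auto
      then show "((\<lambda>x. ?f x s) \<longlongrightarrow> 0) at_top"
        by (rule tendsto_eventually)
    qed
  qed auto
  moreover have "(LINT s|lborel. ?f x s) = \<alpha> * W_bar \<alpha> F x" for x
    by (simp add: W_bar_def set_lebesgue_integral_def mult.assoc mult.left_commute[of _ \<alpha>])
  ultimately have "((\<lambda>x. \<alpha> * W_bar \<alpha> F x / \<alpha>) \<longlongrightarrow> 0 / \<alpha>) at_top"
    using alpha_pos by (intro tendsto_divide) auto
  then show ?thesis
    using alpha_pos by simp
qed

end

text \<open>Here \<open>a\<close>, \<open>f\<close>, \<open>w\<close> stand for the values at \<open>x\<close> of \<open>x\<^sup>\<alpha>\<close>, \<open>1 - F\<close> and the weighted tail, and \<open>D / a\<close>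
  for \<open>1 - G\<close>. Both normalised remainders become expressions in \<open>r\<close>, \<open>D\<close> and \<open>w\<close>, which have finite
  limits, while the divergent \<open>a\<close> and the vanishing \<open>f\<close> cancel exactly. No error term has to be
  estimated.\<close>

lemma renewal_remainder_identities:
  fixes \<alpha> a f m w D :: real
  assumes "a > 0" "f > 0" "m > 0" "D > 0" and D: "D = m - \<alpha> * w"
  defines "R \<equiv> 2 / (D / a) - f / (D / a)\<^sup>2" and "r \<equiv> w / (a * f)"
  shows "1 / (a\<^sup>2 * f) * (R - 2 / m * a) = 2 * \<alpha> / (m * D) * r - 1 / D\<^sup>2"
    and "1 / (a ^ 3 * f\<^sup>2) * (R - 2 * a / m - 2 * \<alpha> * a * w / m\<^sup>2 + a\<^sup>2 * f / m\<^sup>2) =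
      2 * \<alpha>\<^sup>2 / (m\<^sup>2 * D) * r\<^sup>2 - (2 * \<alpha> * m - \<alpha>\<^sup>2 * w) / (m\<^sup>2 * D\<^sup>2) * r"
proof -
  have R: "R = 2 * a / D - a\<^sup>2 * f / D\<^sup>2"
    using assms(1-4) by (simp add: R_def power_divide divide_simps)
  have w: "w = r * (a * f)"
    using assms(1,2) by (simp add: r_def)
  have m: "m = D + \<alpha> * w"
    by (simp add: D)
  have 1: "2 * a / D - 2 * a / m = 2 * a * (\<alpha> * w) / (m * D)"
    using assms(1-4) unfolding m by (simp add: field_simps)
  have "R - 2 / m * a = a\<^sup>2 * f * (2 * \<alpha> / (m * D) * r - 1 / D\<^sup>2)"
  proof -
    have "R - 2 / m * a = 2 * a * (\<alpha> * w) / (m * D) - a\<^sup>2 * f / D\<^sup>2"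
      using 1 by (simp add: R)
    also have "\<dots> = a\<^sup>2 * f * (2 * \<alpha> / (m * D) * r - 1 / D\<^sup>2)"
      by (simp add: w algebra_simps power2_eq_square)
    finally show ?thesis .
  qed
  then show "1 / (a\<^sup>2 * f) * (R - 2 / m * a) = 2 * \<alpha> / (m * D) * r - 1 / D\<^sup>2"
    using assms(1,2) by simp
  have 2: "2 * a / D - 2 * a / m - 2 * \<alpha> * a * w / m\<^sup>2 = 2 * a * (\<alpha> * w)\<^sup>2 / (m\<^sup>2 * D)"
    using assms(1-4) unfolding D by (simp add: divide_simps) (simp add: algebra_simps power2_eq_square)
  have 3: "1 / D\<^sup>2 - 1 / m\<^sup>2 = (2 * \<alpha> * m - \<alpha>\<^sup>2 * w) * w / (m\<^sup>2 * D\<^sup>2)"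
    using assms(1-4) unfolding D by (simp add: divide_simps) (simp add: algebra_simps power2_eq_square)
  have "R - 2 * a / m - 2 * \<alpha> * a * w / m\<^sup>2 + a\<^sup>2 * f / m\<^sup>2 =
      (2 * a / D - 2 * a / m - 2 * \<alpha> * a * w / m\<^sup>2) - a\<^sup>2 * f * (1 / D\<^sup>2 - 1 / m\<^sup>2)"
    by (simp add: R algebra_simps)
  also have "\<dots> = 2 * a * (\<alpha> * w)\<^sup>2 / (m\<^sup>2 * D) - a\<^sup>2 * f * ((2 * \<alpha> * m - \<alpha>\<^sup>2 * w) * w / (m\<^sup>2 * D\<^sup>2))"
    by (simp only: 2 3)
  also have "\<dots> = 2 * a * (\<alpha> * (r * (a * f)))\<^sup>2 / (m\<^sup>2 * D)
      - a\<^sup>2 * f * ((2 * \<alpha> * m - \<alpha>\<^sup>2 * w) * (r * (a * f)) / (m\<^sup>2 * D\<^sup>2))"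
    by (simp only: flip: w)
  also have "\<dots> = (a ^ 3 * f\<^sup>2) * (2 * \<alpha>\<^sup>2 / (m\<^sup>2 * D) * r\<^sup>2 - (2 * \<alpha> * m - \<alpha>\<^sup>2 * w) / (m\<^sup>2 * D\<^sup>2) * r)"
    by (simp add: algebra_simps power2_eq_square power3_eq_cube)
  finally show "1 / (a ^ 3 * f\<^sup>2) * (R - 2 * a / m - 2 * \<alpha> * a * w / m\<^sup>2 + a\<^sup>2 * f / m\<^sup>2) =
      2 * \<alpha>\<^sup>2 / (m\<^sup>2 * D) * r\<^sup>2 - (2 * \<alpha> * m - \<alpha>\<^sup>2 * w) / (m\<^sup>2 * D\<^sup>2) * r"
    using assms(1,2) by simp
qed

theorem theorem6:
  fixes \<alpha> \<beta> m :: real and M :: "'a measure" and X :: "'a \<Rightarrow> real" and F :: "real \<Rightarrow> real"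
  assumes "\<alpha> > 0"
    and "prob_space M"
    and "X \<in> borel_measurable M"
    and "AE \<omega> in M. X \<omega> > 0"
    and "F = cdf (distr M borel X)"
    and "continuous_on UNIV F"
    and "integrable M (\<lambda>\<omega>. X \<omega> powr \<alpha>)"
    and "m = prob_space.expectation M (\<lambda>\<omega>. X \<omega> powr \<alpha>)"
    and "(\<lambda>x. 1 - F x) \<in> RV (- \<beta>)"
    and "\<beta> > \<alpha>"
  shows "((\<lambda>x. 1 / (x powr (2 * \<alpha>) * (1 - F x)) *
              (kendall_renewal \<alpha> F x - 2 / m * x powr \<alpha>))
            \<longlongrightarrow> (3 * \<alpha> - \<beta>) / ((\<beta> - \<alpha>) * m ^ 2)) at_top \<and>
         ((\<lambda>x. 1 / (x powr (3 * \<alpha>) * (1 - F x) ^ 2) *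
              (kendall_renewal \<alpha> F x - 2 * x powr \<alpha> / m
                - 2 * \<alpha> * x powr \<alpha> * W_bar \<alpha> F x / m ^ 2
                + x powr (2 * \<alpha>) * (1 - F x) / m ^ 2))
            \<longlongrightarrow> 2 * \<alpha> * (2 * \<alpha> - \<beta>) / (m ^ 3 * (\<beta> - \<alpha>) ^ 2)) at_top"
proof -
  note [measurable] = assms(3)
  let ?D = "distr M borel X"
  interpret M: prob_space M by fact
  interpret D: real_distribution ?D
    by (rule M.real_distribution_distr) fact
  have F: "F = cdf ?D" by fact
  have AE_pos: "AE t in ?D. 0 < t"
    using assms(4) by (subst AE_distr_iff) auto
  have isCont_F: "isCont F x" for x
    using assms(6) by (simp add: continuous_on_eq_continuous_at)
  have F0: "F 0 = 0"
  proof -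
    have "D.prob {..0} = 0"
      using AE_pos by (subst D.prob_eq_0) (auto elim!: eventually_mono)
    then show ?thesis
      by (simp add: F cdf_def)
  qed
  have "nonneg_distribution_function F"
    unfolding nonneg_distribution_function_def
  proof (intro conjI allI)
    show "(F \<longlongrightarrow> 0) (at_left 0)"
      using isCont_F[of 0] F0 by (auto simp: isCont_def intro: tendsto_within_subset)
  qed (auto simp: F intro!: monoI D.cdf_nondecreasing D.cdf_is_right_cont D.cdf_lim_at_bot D.cdf_lim_at_top_prob)
  then interpret continuous_kendall \<alpha> F
    using assms(1) isCont_F by unfold_locales
  have int_D: "integrable ?D (\<lambda>t. t powr \<alpha>)"
    using assms(7) by (simp add: integrable_distr_eq)
  have m_D: "m = D.expectation (\<lambda>t. t powr \<alpha>)"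
    using assms(8) by (simp add: integral_distr)
  have AE0: "AE t in ?D. 0 \<le> t"
    using AE_pos by eventually_elim simp
  note tail = D.expectation_powr_eq_tail_integral[OF alpha_pos AE0 int_D, folded F m_D]
  define f where "f = (\<lambda>x. 1 - F x)"
  define W where "W = W_bar \<alpha> F"
  define D where "D = (\<lambda>x. m - \<alpha> * W x)"
  define r where "r = (\<lambda>x. W x / (x powr \<alpha> * f x))"
  have f_pos: "f x > 0" if "x > 0" for x
    using assms(9) that by (simp add: RV_def f_def)
  have D_eq: "x powr \<alpha> * (1 - G x) = D x" if "x > 0" for x
    using powr_mult_one_minus_G[OF tail(1) that] by (simp add: tail(2) D_def W_def)
  have D_pos: "D x > 0" if "x > 0" for x
    unfolding D_eq[OF that, symmetric] using f_pos[OF that] G_le_F[of x] that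
    by (auto simp: f_def intro!: mult_pos_pos)
  \<comment> \<open>Combined with \<open>m - \<alpha> W 1 > 0\<close> this shows \<open>m > 0\<close>.\<close>
  have W_nonneg: "W x \<ge> 0" for x
    unfolding W_def W_bar_def set_lebesgue_integral_def using F_le_1
    by (intro integral_nonneg_AE) auto
  have m_pos: "m > 0"
    using D_pos[of 1] mult_nonneg_nonneg[OF less_imp_le[OF alpha_pos] W_nonneg[of 1]] by (simp add: D_def)
  have W_lim: "(W \<longlongrightarrow> 0) at_top"
    unfolding W_def by (rule tendsto_W_bar) (rule tail(1))
  have D_lim: "(D \<longlongrightarrow> m) at_top"
  proof -
    have "(D \<longlongrightarrow> m - \<alpha> * 0) at_top"
      unfolding D_def by (intro tendsto_intros W_lim)
    then show ?thesis by simp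
  qed
  have r_lim: "(r \<longlongrightarrow> 1 / (\<beta> - \<alpha>)) at_top"
    unfolding r_def W_def W_bar_def f_def
    using assms(9,10) alpha_pos F_mono by (intro Karamata_tail_integral) auto
  have R: "kendall_renewal \<alpha> F x = 2 / (D x / x powr \<alpha>) - f x / (D x / x powr \<alpha>)\<^sup>2" if "x > 0" for x
  proof -
    have "1 - G x = D x / x powr \<alpha>"
      using D_eq[OF that] that by (simp add: field_simps)
    then show ?thesis
      using kendall_renewal_eq[of x] f_pos[OF that] that by (simp add: f_def)
  qed
  have powr_mult: "x powr (real k * \<alpha>) = (x powr \<alpha>) ^ k" if "x > 0" for x k
    using that by (simp add: powr_power mult.commute)
  have first: "1 / (x powr (2 * \<alpha>) * (1 - F x)) * (kendall_renewal \<alpha> F x - 2 / m * x powr \<alpha>) =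
      2 * \<alpha> / (m * D x) * r x - 1 / (D x)\<^sup>2" if x: "x > 0" for x
    using renewal_remainder_identities(1)[of "x powr \<alpha>" "f x" m "D x" \<alpha> "W x"]
      x f_pos[OF x] D_pos[OF x] m_pos R[OF x] powr_mult[OF x, of 2]
    by (simp add: D_def r_def f_def)
  have second: "1 / (x powr (3 * \<alpha>) * (1 - F x) ^ 2) *
        (kendall_renewal \<alpha> F x - 2 * x powr \<alpha> / m
          - 2 * \<alpha> * x powr \<alpha> * W_bar \<alpha> F x / m ^ 2 + x powr (2 * \<alpha>) * (1 - F x) / m ^ 2) =
      2 * \<alpha>\<^sup>2 / (m\<^sup>2 * D x) * (r x)\<^sup>2 - (2 * \<alpha> * m - \<alpha>\<^sup>2 * W x) / (m\<^sup>2 * (D x)\<^sup>2) * r x"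
    if x: "x > 0" for x
    using renewal_remainder_identities(2)[of "x powr \<alpha>" "f x" m "D x" \<alpha> "W x"]
      x f_pos[OF x] D_pos[OF x] m_pos R[OF x] powr_mult[OF x, of 2] powr_mult[OF x, of 3]
    by (simp add: D_def r_def f_def W_def)
  have "((\<lambda>x. 2 * \<alpha> / (m * D x) * r x - 1 / (D x)\<^sup>2) \<longlongrightarrow>
      2 * \<alpha> / (m * m) * (1 / (\<beta> - \<alpha>)) - 1 / m\<^sup>2) at_top"
    using m_pos by (intro tendsto_intros D_lim r_lim) auto
  also have "2 * \<alpha> / (m * m) * (1 / (\<beta> - \<alpha>)) - 1 / m\<^sup>2 = (3 * \<alpha> - \<beta>) / ((\<beta> - \<alpha>) * m ^ 2)"
    using m_pos assms(10) by (simp add: divide_simps power2_eq_square)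
  finally have first_lim: "((\<lambda>x. 2 * \<alpha> / (m * D x) * r x - 1 / (D x)\<^sup>2) \<longlongrightarrow>
      (3 * \<alpha> - \<beta>) / ((\<beta> - \<alpha>) * m ^ 2)) at_top" .
  have "((\<lambda>x. 2 * \<alpha>\<^sup>2 / (m\<^sup>2 * D x) * (r x)\<^sup>2 - (2 * \<alpha> * m - \<alpha>\<^sup>2 * W x) / (m\<^sup>2 * (D x)\<^sup>2) * r x) \<longlongrightarrow>
      2 * \<alpha>\<^sup>2 / (m\<^sup>2 * m) * (1 / (\<beta> - \<alpha>))\<^sup>2 - (2 * \<alpha> * m - \<alpha>\<^sup>2 * 0) / (m\<^sup>2 * m\<^sup>2) * (1 / (\<beta> - \<alpha>))) at_top"
    using m_pos by (intro tendsto_intros D_lim r_lim W_lim) auto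
  also have "2 * \<alpha>\<^sup>2 / (m\<^sup>2 * m) * (1 / (\<beta> - \<alpha>))\<^sup>2 - (2 * \<alpha> * m - \<alpha>\<^sup>2 * 0) / (m\<^sup>2 * m\<^sup>2) * (1 / (\<beta> - \<alpha>)) =
      2 * \<alpha> * (2 * \<alpha> - \<beta>) / (m ^ 3 * (\<beta> - \<alpha>) ^ 2)"
  proof -
    define c where "c = \<beta> - \<alpha>"
    have "c > 0" and \<beta>: "\<beta> = \<alpha> + c"
      using assms(10) by (simp_all add: c_def)
    then show ?thesis
      using m_pos by (simp add: field_simps power2_eq_square power3_eq_cube)
  qed
  finally have second_lim: "((\<lambda>x. 2 * \<alpha>\<^sup>2 / (m\<^sup>2 * D x) * (r x)\<^sup>2
        - (2 * \<alpha> * m - \<alpha>\<^sup>2 * W x) / (m\<^sup>2 * (D x)\<^sup>2) * r x) \<longlongrightarrow>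
      2 * \<alpha> * (2 * \<alpha> - \<beta>) / (m ^ 3 * (\<beta> - \<alpha>) ^ 2)) at_top" .
  show ?thesis
    by (intro conjI Lim_transform_eventually[OF first_lim] Lim_transform_eventually[OF second_lim]
        eventually_mono[OF eventually_gt_at_top[of 0]] first[symmetric] second[symmetric])
qed

end
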